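(* There exist a two-player non-cooperative game whose strategy spaces $\mathbb{A}_1,\mathbb{A}_2$ are both $2$-dimensional simplices (equivalently, homeomorphic to the closed disk $\mathbb{D}^2$) and continuous cost functions $r_1,r_2:\mathbb{A}_1\times\mathbb{A}_2\to\mathbb{R}$ such that both best-response maps $R_1:\mathbb{A}_2\to\mathcal{H}_c(\mathbb{A}_1)$ and $R_2:\mathbb{A}_1\to\mathcal{H}_c(\mathbb{A}_2)$ are continuous, but the game has no Nash equilibrium.
   Context: For a metric space $X$, $\mathcal{H}_c(X)$ is the space of non-empty compact subsets of $X$ with the Hausdorff metric. Each player wants to minimize his cost. The best-response maps are $R_1(a_2)=\{x\in\mathbb{A}_1: r_1(x,a_2)=\min_{y\in\mathbb{A}_1}r_1(y,a_2)\}$ and $R_2(a_1)=\{x\in\mathbb{A}_2: r_2(a_1,x)=\min_{y\in\mathbb{A}_2}r_2(a_1,y)\}$. A Nash equilibrium is a pair $(a_1^*,a_2^* )\in\mathbb{A}_1\times\mathbb{A}_2$ with $a_1^*\in R_1(a_2^* )$ and $a_2^*\in R_2(a_1^* )$. *)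

theory Defs
  imports "HOL-Analysis.Analysis"
begin

(* Suprema of unbounded sets of reals are unspecified, hence the guard; its value is irrelevant
   on compact_sets. *)
definition hausdorff_dist :: "'a::metric_space set \<Rightarrow> 'a set \<Rightarrow> real" where
  "hausdorff_dist K L =
     (if K = {} \<or> L = {} \<or> \<not> bounded K \<or> \<not> bounded L then 0
      else max (SUP x\<in>K. infdist x L) (SUP y\<in>L. infdist y K))"

definition compact_sets :: "'a::metric_space set \<Rightarrow> 'a set set" where
  "compact_sets X = {K. K \<subseteq> X \<and> K \<noteq> {} \<and> compact K}"

definition hausdorff_topology :: "'a::metric_space set \<Rightarrow> 'a set topology" where
  "hausdorff_topology X = Metric_space.mtopology (compact_sets X) hausdorff_dist"

definition best_response1 :: "'a set \<Rightarrow> ('a \<times> 'b \<Rightarrow> real) \<Rightarrow> 'b \<Rightarrow> 'a set" where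
  "best_response1 A1 r1 a2 = {x. is_arg_min (\<lambda>y. r1 (y, a2)) (\<lambda>y. y \<in> A1) x}"

definition best_response2 :: "'b set \<Rightarrow> ('a \<times> 'b \<Rightarrow> real) \<Rightarrow> 'a \<Rightarrow> 'b set" where
  "best_response2 A2 r2 a1 = {x. is_arg_min (\<lambda>y. r2 (a1, y)) (\<lambda>y. y \<in> A2) x}"

definition nash_equilibrium ::
    "'a set \<Rightarrow> 'b set \<Rightarrow> ('a \<times> 'b \<Rightarrow> real) \<Rightarrow> ('a \<times> 'b \<Rightarrow> real) \<Rightarrow> 'a \<times> 'b \<Rightarrow> bool" where
  "nash_equilibrium A1 A2 r1 r2 = (\<lambda>(a1, a2). (a1, a2) \<in> A1 \<times> A2 \<and>
     a1 \<in> best_response1 A1 r1 a2 \<and> a2 \<in> best_response2 A2 r2 a1)"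

lemma bdd_above_infdist:
  fixes K L :: "'a::metric_space set"
  assumes "bounded K"
  shows "bdd_above ((\<lambda>x. infdist x L) ` K)"
proof -
  obtain a e where e: "\<And>x. x \<in> K \<Longrightarrow> dist a x \<le> e"
    using assms unfolding bounded_def by blast
  show ?thesis
  proof (rule bdd_aboveI2)
    fix x assume "x \<in> K"
    then show "infdist x L \<le> infdist a L + e"
      using infdist_triangle[of x L a] e by (fastforce simp: dist_commute)
  qed
qed

lemma hausdorff_dist_nonneg: "0 \<le> hausdorff_dist K L"
proof (cases "K = {} \<or> L = {} \<or> \<not> bounded K \<or> \<not> bounded L")
  case False
  then obtain x where x: "x \<in> K" by blast
  have "0 \<le> infdist x L" by (rule infdist_nonneg)
  also have "\<dots> \<le> (SUP x\<in>K. infdist x L)"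
    using False x by (intro cSUP_upper bdd_above_infdist) auto
  finally show ?thesis using False by (simp add: hausdorff_dist_def)
qed (simp add: hausdorff_dist_def)

lemma hausdorff_dist_le_iff:
  assumes "K \<in> compact_sets X" "L \<in> compact_sets X"
  shows "hausdorff_dist K L \<le> e \<longleftrightarrow> (\<forall>x\<in>K. infdist x L \<le> e) \<and> (\<forall>y\<in>L. infdist y K \<le> e)"
proof -
  have *: "K \<noteq> {}" "L \<noteq> {}" "bounded K" "bounded L"
    using assms by (auto simp: compact_sets_def compact_imp_bounded)
  then show ?thesis
    by (simp add: hausdorff_dist_def cSUP_le_iff bdd_above_infdist)
qed

lemma Metric_space_compact_sets: "Metric_space (compact_sets X) hausdorff_dist"
proof
  fix K L M :: "'a set"
  show "0 \<le> hausdorff_dist K L" by (rule hausdorff_dist_nonneg)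
  show "hausdorff_dist K L = hausdorff_dist L K"
    by (auto simp: hausdorff_dist_def max.commute)
  assume K: "K \<in> compact_sets X" and L: "L \<in> compact_sets X"
  have ne: "K \<noteq> {}" "L \<noteq> {}" and cl: "closed K" "closed L"
    using K L by (auto simp: compact_sets_def compact_imp_closed)
  have le_iff: "infdist x S \<le> 0 \<longleftrightarrow> infdist x S = 0" for x and S :: "'a set"
    using infdist_nonneg[of x S] by linarith
  have "hausdorff_dist K L = 0 \<longleftrightarrow> hausdorff_dist K L \<le> 0"
    using hausdorff_dist_nonneg[of K L] by linarith
  also have "\<dots> \<longleftrightarrow> (\<forall>x\<in>K. infdist x L = 0) \<and> (\<forall>y\<in>L. infdist y K = 0)"
    unfolding hausdorff_dist_le_iff[OF K L] by (simp add: le_iff)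
  also have "\<dots> \<longleftrightarrow> K = L"
    using in_closed_iff_infdist_zero[OF cl(1) ne(1)] in_closed_iff_infdist_zero[OF cl(2) ne(2)]
    by blast
  finally show "hausdorff_dist K L = 0 \<longleftrightarrow> K = L" .
next
  fix K L M :: "'a set"
  assume K: "K \<in> compact_sets X" and L: "L \<in> compact_sets X" and M: "M \<in> compact_sets X"
  have step: "infdist x R \<le> hausdorff_dist P Q + hausdorff_dist Q R"
    if P: "P \<in> compact_sets X" and Q: "Q \<in> compact_sets X" and R: "R \<in> compact_sets X"
      and x: "x \<in> P" for P Q R x
  proof -
    have PQ: "infdist x Q \<le> hausdorff_dist P Q"
      using hausdorff_dist_le_iff[OF P Q] x by blast
    have Q': "compact Q" "Q \<noteq> {}"
      using Q by (auto simp: compact_sets_def)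
    have "continuous_on Q (dist x)"
      by (intro continuous_intros)
    then obtain q where q: "q \<in> Q" and min: "\<And>y. y \<in> Q \<Longrightarrow> dist x q \<le> dist x y"
      using continuous_attains_inf[OF Q'] by metis
    have xq: "dist x q \<le> infdist x Q"
      unfolding infdist_notempty[OF Q'(2)] by (rule cINF_greatest[OF Q'(2) min])
    have QR: "infdist q R \<le> hausdorff_dist Q R"
      using hausdorff_dist_le_iff[OF Q R] q by blast
    show ?thesis using infdist_triangle[of x R q] PQ QR xq by linarith
  qed
  have comm: "hausdorff_dist P Q = hausdorff_dist Q P" for P Q :: "'a set"
    by (auto simp: hausdorff_dist_def max.commute)
  show "hausdorff_dist K M \<le> hausdorff_dist K L + hausdorff_dist L M"
    unfolding hausdorff_dist_le_iff[OF K M]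
    using step[OF K L M] step[OF M L K] by (simp add: comm[of M L] comm[of L K] add.commute)
qed

end

theory Submission
  imports Defs
begin

text \<open>
  On the closed unit disc consider \<open>F(z) = {w. |w - z| \<ge> 1/2}\<close>. It has no fixed point, and it
  varies continuously with \<open>z\<close>, because the distance to a fixed point \<open>q\<close> of the disc has no local
  maximum with a value in \<open>(0, 1)\<close>: an interior point can move radially away from \<open>q\<close>, a boundary
  point can slide along the circle. Taking \<open>F\<close> as the best response of player 1, while player 2
  copies player 1, excludes equilibria. A triangle itself would not do, since the distance has
  local maxima at the vertices, so \<open>F\<close> is transported along a homeomorphism with the disc.
\<close>

text \<open>Splits continuity at \<open>z\<close> into its lower and upper semicontinuous halves,
  with no suprema left. Non-strict bounds suffice because they are used with
  \<open>e/2\<close>.\<close>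

lemma continuous_map_hausdorffI:
  fixes F :: "'b::topological_space \<Rightarrow> 'a::metric_space set"
  assumes F: "\<And>z. z \<in> T \<Longrightarrow> F z \<in> compact_sets X"
    and near: "\<And>z e. z \<in> T \<Longrightarrow> 0 < e \<Longrightarrow>
      \<exists>V. openin (top_of_set T) V \<and> z \<in> V \<and>
        (\<forall>y\<in>V. (\<forall>x\<in>F z. infdist x (F y) \<le> e) \<and> (\<forall>x\<in>F y. infdist x (F z) \<le> e))"
  shows "continuous_map (top_of_set T) (hausdorff_topology X) F"
proof -
  interpret Metric_space "compact_sets X" hausdorff_dist
    by (rule Metric_space_compact_sets)
  show ?thesis
    unfolding hausdorff_topology_def continuous_map_to_metric
  proof (intro ballI allI impI)
    fix z e assume "z \<in> topspace (top_of_set T)" and e: "(0::real) < e"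
    then have z: "z \<in> T" by simp
    obtain V where V: "openin (top_of_set T) V" "z \<in> V"
      and le: "\<And>y. y \<in> V \<Longrightarrow> (\<forall>x\<in>F z. infdist x (F y) \<le> e/2) \<and> (\<forall>x\<in>F y. infdist x (F z) \<le> e/2)"
      using near[OF z, of "e/2"] e by auto
    have "F y \<in> mball (F z) e" if y: "y \<in> V" for y
    proof -
      have yT: "y \<in> T" using V(1) y openin_imp_subset by blast
      have "hausdorff_dist (F z) (F y) \<le> e/2"
        using hausdorff_dist_le_iff[OF F[OF z] F[OF yT]] le[OF y] by blast
      then show ?thesis using F[OF z] F[OF yT] e by simp
    qed
    then show "\<exists>U. openin (top_of_set T) U \<and> z \<in> U \<and> (\<forall>y\<in>U. F y \<in> mball (F z) e)"
      using V by blast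
  qed
qed

lemma continuous_map_hausdorff_singleton:
  "continuous_map (top_of_set X) (hausdorff_topology X) (\<lambda>x::'a::metric_space. {x})"
proof (rule continuous_map_hausdorffI)
  fix z :: 'a and e :: real assume "z \<in> X" "0 < e"
  then show "\<exists>V. openin (top_of_set X) V \<and> z \<in> V \<and>
      (\<forall>y\<in>V. (\<forall>x\<in>{z}. infdist x {y} \<le> e) \<and> (\<forall>x\<in>{y}. infdist x {z} \<le> e))"
    by (intro exI[of _ "X \<inter> ball z e"]) (auto simp: dist_commute)
qed (simp add: compact_sets_def)

text \<open>Compactness of \<open>X\<close> keeps nearby sublevel sets from reaching far outside the
  one at \<open>z\<close>. That they do not shrink abruptly is due to \<open>strict\<close>: a point
  of the sublevel set is approximated by points with value below \<open>c\<close>, and these survive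
  small changes of \<open>z\<close>. The tube lemma makes both effects uniform in
  \<open>x\<close>.\<close>

lemma continuous_map_hausdorff_sublevel:
  fixes X :: "'a::euclidean_space set" and T :: "'b::euclidean_space set"
    and g :: "'a \<times> 'b \<Rightarrow> real"
  assumes X: "compact X" and g: "continuous_on (X \<times> T) g"
    and ne: "\<And>z. z \<in> T \<Longrightarrow> {x \<in> X. g (x, z) \<le> c} \<noteq> {}"
    and strict: "\<And>z. z \<in> T \<Longrightarrow> {x \<in> X. g (x, z) \<le> c} \<subseteq> closure {x \<in> X. g (x, z) < c}"
  shows "continuous_map (top_of_set T) (hausdorff_topology X) (\<lambda>z. {x \<in> X. g (x, z) \<le> c})"
    (is "continuous_map _ _ ?F")
proof (rule continuous_map_hausdorffI)
  have cl: "closed X" by (rule compact_imp_closed[OF X])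
  have g1: "continuous_on X (\<lambda>x. g (x, z))" if "z \<in> T" for z
    by (rule continuous_on_compose2[OF g]) (use that in \<open>auto intro!: continuous_intros\<close>)
  have g2: "continuous_on T (\<lambda>z. g (x, z))" if "x \<in> X" for x
    by (rule continuous_on_compose2[OF g]) (use that in \<open>auto intro!: continuous_intros\<close>)
  have comp: "compact (?F z)" if z: "z \<in> T" for z
  proof -
    have "closedin (top_of_set X) {x \<in> X. g (x, z) \<in> {..c}}"
      using continuous_closedin_preimage[OF g1[OF z] closed_atMost, of c]
      by (simp add: vimage_def Int_def)
    then show ?thesis using X closedin_compact by fastforce
  qed
  show F: "?F z \<in> compact_sets X" if "z \<in> T" for z
    using comp ne that unfolding compact_sets_def by blast
  fix z e assume z: "z \<in> T" and e: "(0::real) < e"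
  have Xne: "X \<noteq> {}" using ne[OF z] by blast
  \<comment> \<open>For \<open>x\<close> in \<open>?F z\<close>, membership of \<open>(x, y)\<close>
    in \<open>U\<close> yields a point of \<open>?F y\<close> within \<open>e\<close> of
    \<open>x\<close>. The second piece covers the remaining \<open>x\<close>, so that the whole
    slice over \<open>z\<close> lies in \<open>U\<close>.\<close>
  define U where
    "U = (\<Union>w\<in>X. (X \<inter> ball w e) \<times> {y \<in> T. g (w, y) < c}) \<union> {x \<in> X. c < g (x, z)} \<times> T"
  have oU: "openin (top_of_set (X \<times> T)) U"
  proof -
    have "openin (top_of_set T) {y \<in> T. g (w, y) < c}" if "w \<in> X" for w
      using continuous_openin_preimage_gen[OF g2[OF that] open_lessThan, of c]
      by (simp add: vimage_def Int_def)
    moreover have "openin (top_of_set X) {x \<in> X. c < g (x, z)}"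
      using continuous_openin_preimage_gen[OF g1[OF z] open_greaterThan, of c]
      by (simp add: vimage_def Int_def)
    ultimately show ?thesis unfolding U_def
      by (auto intro!: openin_Un openin_Union openin_Times)
  qed
  have "(\<lambda>x. (x, z)) ` X \<subseteq> U"
  proof clarify
    fix x assume x: "x \<in> X"
    show "(x, z) \<in> U"
    proof (cases "c < g (x, z)")
      case False
      then have "x \<in> closure {x \<in> X. g (x, z) < c}" using x strict[OF z] by auto
      then obtain w where "w \<in> X" "g (w, z) < c" "dist w x < e"
        using e unfolding closure_approachable by blast
      then show ?thesis using x z unfolding U_def by auto
    qed (use x z in \<open>auto simp: U_def\<close>)
  qed
  then obtain V1 where V1: "openin (top_of_set T) V1" "z \<in> V1" "X \<times> V1 \<subseteq> U"
    using Retracts.tube_lemma[OF X Xne _ oU, of z] by blast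
  \<comment> \<open>The mirror image of \<open>U\<close>: if \<open>(x, y)\<close> is in
    \<open>W\<close> and \<open>x\<close> in \<open>?F y\<close>, the first piece is excluded when
    \<open>p = (x, y)\<close>, so \<open>x\<close> is within \<open>e\<close> of
    \<open>?F z\<close>.\<close>
  define W where "W = {p \<in> X \<times> T. c < g p} \<union> {x \<in> X. infdist x (?F z) < e} \<times> T"
  have oW: "openin (top_of_set (X \<times> T)) W"
  proof -
    have "openin (top_of_set (X \<times> T)) {p \<in> X \<times> T. c < g p}"
      using continuous_openin_preimage_gen[OF g open_greaterThan, of c]
      by (simp add: vimage_def Int_def)
    moreover have "openin (top_of_set X) {x \<in> X. infdist x (?F z) < e}"
      using continuous_openin_preimage_gen
          [OF continuous_on_infdist[OF continuous_on_id] open_lessThan, of X "?F z" e]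
      by (simp add: vimage_def Int_def)
    ultimately show ?thesis unfolding W_def by (intro openin_Un openin_Times) auto
  qed
  have "(\<lambda>x. (x, z)) ` X \<subseteq> W"
    using z e by (auto simp: W_def not_less)
  then obtain V2 where V2: "openin (top_of_set T) V2" "z \<in> V2" "X \<times> V2 \<subseteq> W"
    using Retracts.tube_lemma[OF X Xne _ oW, of z] by blast
  have "infdist x (?F y) \<le> e" if y: "y \<in> V1" and x: "x \<in> ?F z" for x y
  proof -
    have "(x, y) \<in> U" using V1(3) x y by auto
    then obtain w where "w \<in> ?F y" "dist w x < e"
      using x unfolding U_def by force
    then show ?thesis using infdist_le2[of w "?F y" x e] by (simp add: dist_commute)
  qed
  moreover have "infdist x (?F z) \<le> e" if "y \<in> V2" and "x \<in> ?F y" for x y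
  proof -
    have "(x, y) \<in> W" using V2(3) that by auto
    then show ?thesis using that unfolding W_def by auto
  qed
  ultimately show "\<exists>V. openin (top_of_set T) V \<and> z \<in> V \<and>
      (\<forall>y\<in>V. (\<forall>x\<in>?F z. infdist x (?F y) \<le> e) \<and> (\<forall>x\<in>?F y. infdist x (?F z) \<le> e))"
    using V1 V2 by (intro exI[of _ "V1 \<inter> V2"]) (blast intro: openin_Int)
qed

text \<open>Provides the approximation by strict inequalities in the disc. The bound 1 is sharp: for
  \<open>q = 0\<close> every boundary point is at the maximal distance 1.\<close>

lemma disc_dist_no_local_max:
  fixes p q :: complex
  assumes p: "norm p \<le> 1" and pq: "p \<noteq> q" "dist p q < 1"
  shows "p \<in> closure {u \<in> cball 0 1. dist p q < dist u q}" (is "_ \<in> closure ?S")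
proof -
  \<comment> \<open>A curve that runs in \<open>?S\<close> for small \<open>t > 0\<close> and tends
    to \<open>p\<close> puts \<open>p\<close> into the closure.\<close>
  have "\<exists>\<gamma>::real \<Rightarrow> complex. (\<gamma> \<longlongrightarrow> p) (at_right 0) \<and> (\<forall>\<^sub>F t in at_right 0. \<gamma> t \<in> ?S)"
  proof (cases "norm p < 1")
    case True
    let ?\<gamma> = "\<lambda>t::real. p + of_real t * (p - q)"
    have lim: "(?\<gamma> \<longlongrightarrow> p) (at_right 0)" by (auto intro!: tendsto_eq_intros)
    have "\<forall>\<^sub>F t in at_right 0. norm (?\<gamma> t) < 1"
      using order_tendstoD(2)[OF tendsto_norm[OF lim] True] .
    moreover have "\<forall>\<^sub>F t in at_right (0::real). 0 < t"
      by (simp add: eventually_at_right_less)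
    ultimately have "\<forall>\<^sub>F t in at_right 0. ?\<gamma> t \<in> ?S"
    proof eventually_elim
      case (elim t)
      have "?\<gamma> t - q = of_real (1 + t) * (p - q)" by (simp add: algebra_simps)
      then have "dist (?\<gamma> t) q = (1 + t) * dist p q"
        using elim by (simp only: dist_norm norm_mult norm_of_real)
      then show ?case using elim pq by (simp add: algebra_simps)
    qed
    then show ?thesis using lim by blast
  next
    case False
    then have np: "norm p = 1" using p by simp
    let ?a = "Re (p * cnj q)" and ?b = "Im (p * cnj q)"
    \<comment> \<open>The direction of rotation is chosen so that the sine term in the real part of
      \<open>?\<gamma> t * cnj q\<close> becomes \<open>- \<bar>?b\<bar> * sin t\<close>, which
      cannot increase it.\<close>
    define s :: real where "s = (if 0 \<le> ?b then 1 else -1)"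
    let ?\<gamma> = "\<lambda>t::real. p * cis (s * t)"
    \<comment> \<open>Law of cosines: on the unit circle, the distance to \<open>q\<close> grows
      exactly when \<open>Re (u * cnj q)\<close> decreases.\<close>
    have sq: "(dist u q)\<^sup>2 = 1 + (norm q)\<^sup>2 - 2 * Re (u * cnj q)" if "norm u = 1" for u
      using that unfolding dist_norm cmod_power2[of "u - q"] cmod_power2[of q]
      by (simp add: cmod_def power2_eq_square algebra_simps)
    have a: "0 < ?a"
    proof -
      have "(dist p q)\<^sup>2 < 1" using pq by (simp add: power_less_one_iff abs_square_less_1)
      then show ?thesis using sq[OF np] zero_le_power2[of "norm q"] by linarith
    qed
    have lim: "(?\<gamma> \<longlongrightarrow> p) (at_right 0)"
    proof -
      have "isCont ?\<gamma> 0" unfolding cis_conv_exp by (intro continuous_intros)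
      then show ?thesis unfolding isCont_def using tendsto_mono[OF at_le] by force
    qed
    have "\<forall>\<^sub>F t in at_right (0::real). t \<in> {0<..<1}"
      by (rule eventually_at_right_real) simp
    then have "\<forall>\<^sub>F t in at_right 0. ?\<gamma> t \<in> ?S"
    proof eventually_elim
      case (elim t)
      have n: "norm (?\<gamma> t) = 1" using np by (simp add: norm_mult)
      have "0 < sin t" using elim pi_gt3 by (intro sin_gt_zero) auto
      moreover have "cos t < 1" using cos_monotone_0_pi[of 0 t] elim pi_gt3 by auto
      moreover have "Re (?\<gamma> t * cnj q) = ?a * cos t - \<bar>?b\<bar> * sin t"
        by (simp add: s_def cis.ctr algebra_simps)
      ultimately have "Re (?\<gamma> t * cnj q) < ?a"
        using a mult_strict_left_mono[of "cos t" 1 ?a] mult_nonneg_nonneg[of "\<bar>?b\<bar>" "sin t"]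
        by linarith
      then have "(dist p q)\<^sup>2 < (dist (?\<gamma> t) q)\<^sup>2" using sq[OF np] sq[OF n] by linarith
      then show ?case using n power_less_imp_less_base[of "dist p q" 2] by simp
    qed
    then show ?thesis using lim by blast
  qed
  then obtain \<gamma> :: "real \<Rightarrow> complex"
    where "(\<gamma> \<longlongrightarrow> p) (at_right 0)" and S: "\<forall>\<^sub>F t in at_right 0. \<gamma> t \<in> ?S"
    by blast
  show ?thesis
  proof (rule Lim_in_closed_set)
    show "\<forall>\<^sub>F t in at_right 0. \<gamma> t \<in> closure ?S"
      using S by eventually_elim (rule closure_subset[THEN subsetD])
  qed (use \<open>(\<gamma> \<longlongrightarrow> p) (at_right 0)\<close> in auto)
qed

text \<open>An affine basis of the plane has three points, and its convex hull is a
  triangle.\<close>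

lemma ex_simplex_real2: "\<exists>A :: (real^2) set. 2 simplex A"
proof -
  obtain C :: "(real^2) set" where "\<not> affine_dependent C" "affine hull C = UNIV"
    using affine_basis_exists[of "UNIV :: (real^2) set"] by auto
  then have "int (card C) = 2 + 1"
    using aff_dim_affine_hull[of C] by (simp add: affine_independent_iff_card)
  then show ?thesis
    using \<open>\<not> affine_dependent C\<close> simplex_convex_hull by blast
qed

theorem mainTheorem4:
  shows "\<exists>(A1 :: (real^2) set) (A2 :: (real^2) set)
           (r1 :: (real^2) \<times> (real^2) \<Rightarrow> real) (r2 :: (real^2) \<times> (real^2) \<Rightarrow> real).
           2 simplex A1 \<and> 2 simplex A2 \<and>
           continuous_on (A1 \<times> A2) r1 \<and> continuous_on (A1 \<times> A2) r2 \<and>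
           continuous_map (top_of_set A2) (hausdorff_topology A1) (best_response1 A1 r1) \<and>
           continuous_map (top_of_set A1) (hausdorff_topology A2) (best_response2 A2 r2) \<and>
           \<not> (\<exists>a. nash_equilibrium A1 A2 r1 r2 a)"
proof -
  obtain A :: "(real^2) set" where A: "2 simplex A"
    using ex_simplex_real2 by blast
  let ?D = "cball (0::complex) 1"
  \<comment> \<open>Both are compact convex sets of affine dimension 2.\<close>
  have "A homeomorphic ?D"
    using A by (intro homeomorphic_convex_compact_sets)
      (auto simp: aff_dim_simplex aff_dim_cball convex_simplex compact_simplex)
  then obtain h k where hk: "homeomorphism A ?D h k"
    unfolding homeomorphic_def by blast
  have h: "continuous_on A h" "\<And>x. x \<in> A \<Longrightarrow> norm (h x) \<le> 1"
    and k: "continuous_on ?D k" "\<And>u. u \<in> ?D \<Longrightarrow> k u \<in> A"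
    and inv: "\<And>x. x \<in> A \<Longrightarrow> k (h x) = x" "\<And>u. u \<in> ?D \<Longrightarrow> h (k u) = u"
    using hk unfolding homeomorphism_def by auto
  \<comment> \<open>The sign turns the points far from \<open>h a\<close> into a sublevel
    set.\<close>
  define g where "g = (\<lambda>(x, a). - dist (h x) (h a))"
  \<comment> \<open>Truncation at 0 makes every point at distance at least 1/2 a minimizer, so the
    best response is all of \<open>?F a\<close>.\<close>
  define r1 where "r1 = (\<lambda>p. max 0 (1/2 + g p))"
  define r2 :: "(real^2) \<times> (real^2) \<Rightarrow> real" where "r2 = (\<lambda>(a, x). dist x a)"
  let ?F = "\<lambda>a. {x \<in> A. g (x, a) \<le> - (1/2)}"
  have g: "continuous_on (A \<times> A) g"
    unfolding g_def case_prod_unfold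
    by (intro continuous_intros continuous_on_compose2[OF h(1)]) auto
  have ne: "?F a \<noteq> {}" for a
  proof -
    \<comment> \<open>The antipodal points 1 and -1 cannot both be close to
      \<open>h a\<close>.\<close>
    have "2 \<le> dist 1 (h a) + dist (-1) (h a)"
      using dist_triangle2[of 1 "-1" "h a"] by (simp add: dist_norm)
    then have "1/2 \<le> dist 1 (h a) \<or> 1/2 \<le> dist (-1) (h a)" by linarith
    then have "\<exists>u\<in>?D. 1/2 \<le> dist u (h a)" by (auto intro: bexI[of _ 1] bexI[of _ "-1"])
    then show ?thesis using k(2) inv(2) by (force simp: g_def)
  qed
  have strict: "?F a \<subseteq> closure {x \<in> A. g (x, a) < - (1/2)}" (is "_ \<subseteq> closure ?G") for a
  proof
    fix x assume "x \<in> ?F a"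
    then have x: "x \<in> A" "1/2 \<le> dist (h x) (h a)" by (auto simp: g_def)
    show "x \<in> closure ?G"
    \<comment> \<open>Only equality needs the disc lemma, whose strictly farther points
      \<open>k\<close> carries back to the triangle.\<close>
    proof (cases "dist (h x) (h a) = 1/2")
      case False
      then show ?thesis using x closure_subset[of ?G] by (auto simp: g_def)
    next
      case True
      let ?S = "{u \<in> ?D. dist (h x) (h a) < dist u (h a)}"
      have "h x \<noteq> h a" "dist (h x) (h a) < 1" using True by auto
      then have "h x \<in> closure ?S"
        by (rule disc_dist_no_local_max[OF h(2)[OF x(1)]])
      moreover have "k ` closure ?S \<subseteq> closure ?G"
      proof (rule image_closure_subset)
        have "closure ?S \<subseteq> ?D" by (rule closure_minimal) auto
        then show "continuous_on (closure ?S) k" using k(1) continuous_on_subset by blast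
        have "k ` ?S \<subseteq> ?G" using k(2) inv(2) True by (auto simp: g_def)
        then show "k ` ?S \<subseteq> closure ?G" using closure_subset by blast
      qed simp
      ultimately show ?thesis using inv(1)[OF x(1)] by force
    qed
  qed
  have R1: "best_response1 A r1 = ?F"
  proof
    fix a
    obtain x where "x \<in> A" "r1 (x, a) = 0" using ne[of a] by (force simp: r1_def)
    then show "best_response1 A r1 a = ?F a"
      unfolding best_response1_def is_arg_min_linorder r1_def by auto
  qed
  have R2: "best_response2 A r2 a = {a}" if "a \<in> A" for a
    using that unfolding best_response2_def is_arg_min_linorder r2_def
    by auto
  have "continuous_map (top_of_set A) (hausdorff_topology A) (best_response1 A r1)"
    unfolding R1
    using continuous_map_hausdorff_sublevel[OF compact_simplex[OF A] g ne strict] .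
  moreover have "continuous_map (top_of_set A) (hausdorff_topology A) (best_response2 A r2)"
    by (rule continuous_map_eq[OF continuous_map_hausdorff_singleton]) (simp add: R2)
  moreover have "continuous_on (A \<times> A) r1" "continuous_on (A \<times> A) r2"
    unfolding r1_def r2_def case_prod_unfold using g by (intro continuous_intros; simp)+
  moreover have "\<not> nash_equilibrium A A r1 r2 p" for p
  proof
    assume "nash_equilibrium A A r1 r2 p"
    \<comment> \<open>Since player 2 copies, both components of \<open>p\<close> are the same point
      \<open>a\<close>.\<close>
    then obtain a where "a \<in> best_response1 A r1 a"
      unfolding nash_equilibrium_def using R2 by (auto split: prod.splits)
    then show False by (simp add: R1 g_def)
  qed
  ultimately show ?thesis using A by blast
qed

end
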